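(* Let $M := 3^{15/2}/(4\cdot 7^{7/2})$. Then for every admissible $5$-tuple $(y_1,\dots,y_5)$ with exactly one pair of complex conjugate non-real entries (that is, admissible for $n=5$, $r_2=1$) one has $$P_{5,1}(y_1,\dots,y_5)\le 16\,M = 16.6965\ldots,$$ and this upper bound is the best possible one (no smaller constant is an upper bound for $P_{5,1}$ on all admissible $5$-tuples).
   Context: For integers $n\ge 2$ and $r_2\ge 0$ with $2r_2\le n$, an $n$-tuple $(y_1,\dots,y_n)$ of complex numbers is called admissible (for $n,r_2$) if: (A) $0<|y_1|\le |y_2|\le\cdots\le|y_n|$; and (B) among the $y_i$ there are $r_2$ pairs of complex conjugate non-real numbers, while all the remaining $y_i$ are real. On admissible $n$-tuples define $$P_{n,r_2}(y_1,\dots,y_n):=\prod_{1\le i<j\le n}\left|1-\frac{y_i}{y_j}\right|.$$ *)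

theory Defs
  imports Complex_Main
begin

text \<open>An \<open>n\<close>-tuple \<open>(y\<^sub>1, \<dots>, y\<^sub>n)\<close> is a function \<open>y :: nat \<Rightarrow> complex\<close> of which only the values at
  the indices in \<open>{1..n}\<close> matter. The \<open>r2\<close> pairs are pairs of indices, so that conjugate pairs may
  occur with multiplicity: \<open>I\<close> and \<open>J\<close> hold the first and second members, and \<open>c\<close> matches them.\<close>

definition admissible :: "nat \<Rightarrow> nat \<Rightarrow> (nat \<Rightarrow> complex) \<Rightarrow> bool" where
  "admissible n r2 y \<longleftrightarrow>
     2 \<le> n \<and> 2 * r2 \<le> n \<and>
     0 < cmod (y 1) \<and> (\<forall>i j. 1 \<le> i \<and> i \<le> j \<and> j \<le> n \<longrightarrow> cmod (y i) \<le> cmod (y j)) \<and>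
     (\<exists>I J c. I \<subseteq> {1..n} \<and> J \<subseteq> {1..n} \<and> I \<inter> J = {} \<and> card I = r2 \<and> bij_betw c I J \<and>
        (\<forall>i\<in>I. y i \<notin> \<real> \<and> y (c i) = cnj (y i)) \<and>
        (\<forall>k\<in>{1..n} - (I \<union> J). y k \<in> \<real>))"

definition P :: "nat \<Rightarrow> (nat \<Rightarrow> complex) \<Rightarrow> real" where
  "P n y = (\<Prod>(i, j) \<in> {(i, j). 1 \<le> i \<and> i < j \<and> j \<le> n}. cmod (1 - y i / y j))"

definition M :: real where
  "M = 3 powr (15 / 2) / (4 * 7 powr (7 / 2))"

end

theory Submission
  imports Defs
begin

text \<open>Scale the conjugate pair to the unit circle, with real part \<open>c\<close> and imaginary parts \<open>\<plusminus> s\<close>, and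
  invert the reals outside the circle. As inversion of the tuple preserves \<open>P\<close>, it suffices to
  treat all three reals inside, or two inside and one outside. Pohst-type inequalities reduce the
  factors between reals to \<open>2 (1 - a\<^sup>2)\<close>, and convexity in the remaining reals pushes these to an
  endpoint. What is left is \<open>(1 - a\<^sup>2) s\<^sup>3 (1 - 2 a c + a\<^sup>2) \<le> M\<close>, a case of AM-GM with equality at
  \<open>a = 1 / \<surd>7\<close>, \<open>c = - a / 2\<close>; the tuple \<open>(a, 1, - 1, c + i s, c - i s)\<close> attains the bound.\<close>

section \<open>Distance factors between a real and the conjugate pair\<close>

text \<open>For \<open>z\<close> on the unit circle with real part \<open>c\<close>, \<open>q c x\<close> is the square of \<open>cmod (1 - x * z)\<close>.\<close>

definition q :: "real \<Rightarrow> real \<Rightarrow> real" where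
  "q c x = 1 - 2 * c * x + x\<^sup>2"

text \<open>Reflection in the imaginary axis changes the sign of \<open>c\<close> and of every real;
  this later fixes the sign of one real.\<close>

lemma q_minus: "q (- c) (- x) = q c x" "q (- c) x = q c (- x)"
  by (simp_all add: q_def)

lemma q_nonneg:
  assumes "\<bar>c\<bar> \<le> 1"
  shows "0 \<le> q c x"
proof -
  have "c\<^sup>2 \<le> 1" using assms by (simp add: abs_square_le_1)
  moreover have "q c x = (x - c)\<^sup>2 + (1 - c\<^sup>2)" by (simp add: q_def power2_eq_square algebra_simps)
  ultimately show ?thesis by simp
qed

lemma q_le_abs: "q c x \<le> 1 + x\<^sup>2 + 2 * \<bar>c\<bar> * \<bar>x\<bar>"
proof -
  have "- (c * x) \<le> \<bar>c\<bar> * \<bar>x\<bar>" by (metis abs_ge_minus_self abs_mult)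
  thus ?thesis by (simp add: q_def)
qed

lemma q_le_square:
  assumes "\<bar>c\<bar> \<le> 1" "\<bar>x\<bar> \<le> y"
  shows "q c x \<le> (1 + y)\<^sup>2"
proof -
  have "\<bar>c\<bar> * \<bar>x\<bar> \<le> 1 * y" using assms by (intro mult_mono) auto
  moreover have "x\<^sup>2 \<le> y\<^sup>2" using assms(2) abs_le_square_iff[of x y] by simp
  ultimately show ?thesis using q_le_abs[of c x] by (simp add: power2_eq_square algebra_simps)
qed

text \<open>\<open>q c\<close> is convex, so on an interval starting at 0 its maximum sits at an
  end. It takes the value \<open>q c 0 = 1\<close> once more at \<open>2 * c\<close>, which is where
  the cases divide.\<close>

lemma q_le_max_zero:
  assumes "0 \<le> x" "x \<le> y"
  shows "q c x \<le> max 1 (q c y)"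
proof (cases "x \<le> 2 * c")
  case True
  have "x * (x - 2 * c) \<le> 0" using assms True by (intro mult_nonneg_nonpos) auto
  thus ?thesis by (simp add: q_def power2_eq_square algebra_simps)
next
  case False
  have "0 \<le> (y - x) * (y + x - 2 * c)" using assms False by (intro mult_nonneg_nonneg) auto
  thus ?thesis by (simp add: q_def power2_eq_square algebra_simps)
qed

lemma q_le_max_pos: "0 \<le> x \<Longrightarrow> x \<le> 1 \<Longrightarrow> q c x \<le> max 1 (2 - 2 * c)"
  using q_le_max_zero[of x 1 c] by (simp add: q_def)

lemma q_le_max_neg: "x \<le> 0 \<Longrightarrow> - 1 \<le> x \<Longrightarrow> q c x \<le> max 1 (2 + 2 * c)"
  using q_le_max_pos[of "- x" "- c"] by (simp add: q_minus)

section \<open>The constant \<open>M\<close>\<close>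

lemma M_nonneg: "0 \<le> M"
  by (simp add: M_def)

text \<open>Squaring clears the half-integer exponents, so that \<open>M\<close> can be compared
  with decimals and with products of integer powers.\<close>

lemma M_square: "M\<^sup>2 = 3 ^ 15 / (16 * 7 ^ 7)"
proof -
  have "(3 powr (15/2))\<^sup>2 = (3::real) powr 15" by (simp add: powr_power)
  moreover have "(7 powr (7/2))\<^sup>2 = (7::real) powr 7" by (simp add: powr_power)
  ultimately show ?thesis by (simp add: M_def power_divide power_mult_distrib)
qed

lemma M_lower: "16.6965 \<le> 16 * M"
proof -
  have "(16.6965 / 16)\<^sup>2 \<le> M\<^sup>2" unfolding M_square by (simp add: power2_eq_square)
  hence "16.6965 / 16 \<le> M" using M_nonneg by (rule power2_le_imp_le)
  thus ?thesis by simp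
qed

lemma M_upper: "16 * M < 16.6966"
proof -
  have "M\<^sup>2 < (16.6966 / 16)\<^sup>2" unfolding M_square by (simp add: power2_eq_square)
  hence "M < 16.6966 / 16" by (rule power_less_imp_less_base) simp
  thus ?thesis by simp
qed

section \<open>The sharp inequality\<close>

text \<open>Weighted AM-GM, obtained from \<open>x \<le> exp (x - 1)\<close>: by the linear
  constraint the exponents add up to 0.\<close>

lemma am_gm_7:
  fixes x y :: real
  assumes "0 \<le> x" "0 \<le> y" "4 * x + 3 * y = 7"
  shows "x ^ 4 * y ^ 3 \<le> 1"
proof -
  have "x \<le> exp (x - 1)" "y \<le> exp (y - 1)"
    using exp_ge_add_one_self[of "x - 1"] exp_ge_add_one_self[of "y - 1"] by auto
  hence "x ^ 4 * y ^ 3 \<le> exp (x - 1) ^ 4 * exp (y - 1) ^ 3"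
    using assms by (intro mult_mono power_mono) auto
  also have "\<dots> = exp (4 * (x - 1) + 3 * (y - 1))"
    by (simp add: exp_of_nat_mult[symmetric] exp_add[symmetric])
  also have "\<dots> = 1" using assms(3) by (simp add: algebra_simps)
  finally show ?thesis .
qed

text \<open>Squaring turns \<open>s ^ 3\<close> into \<open>(1 - g) ^ 3\<close>. Eliminating first
  the sign-dependent term \<open>a * c\<close> and then \<open>A\<close> leaves a polynomial in
  \<open>g\<close> alone, which weighted AM-GM settles.\<close>

lemma core_bound:
  assumes "c\<^sup>2 + s\<^sup>2 = 1" "0 \<le> s" "\<bar>a\<bar> \<le> 1"
  shows "(1 - a\<^sup>2) * s ^ 3 * q c a \<le> M"
proof -
  define A where "A = a\<^sup>2"
  define g where "g = c\<^sup>2"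
  have A: "0 \<le> A" "A \<le> 1" using assms(3) by (simp_all add: A_def abs_square_le_1)
  have g: "0 \<le> g" "g \<le> 1" "s\<^sup>2 = 1 - g" using assms(1) by (auto simp: g_def) (smt (verit) zero_le_power2)
  have c1: "\<bar>c\<bar> \<le> 1" using g by (simp add: g_def abs_square_le_1)
  \<comment> \<open>The weights make this an equality at \<open>a = - 2 c\<close>, where the maximum is attained.\<close>
  have "q c a \<le> 1 + 3 / 2 * A + 2 * g"
  proof -
    have "0 \<le> (2 * c + a)\<^sup>2" by simp
    thus ?thesis by (simp add: q_def A_def g_def power2_eq_square algebra_simps)
  qed
  hence "(1 - A) * q c a \<le> (1 - A) * (1 + 3 / 2 * A + 2 * g)"
    using A by (intro mult_left_mono) auto
  also have "\<dots> \<le> (5 + 4 * g)\<^sup>2 / 24"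
  proof -
    \<comment> \<open>At fixed \<open>g\<close> the maximum over \<open>A\<close> is at
      \<open>6 * A + 4 * g = 1\<close>. Together with \<open>A = 4 * g\<close> this gives
      \<open>A = 1 / 7\<close> and \<open>g = 1 / 28\<close>.\<close>
    have "0 \<le> (6 * A + 4 * g - 1)\<^sup>2" by simp
    thus ?thesis by (simp add: power2_eq_square field_simps)
  qed
  finally have le: "(1 - A) * q c a \<le> (5 + 4 * g)\<^sup>2 / 24" .
  have nn: "0 \<le> (1 - A) * q c a" using A q_nonneg[OF c1] by simp
  have "((1 - a\<^sup>2) * s ^ 3 * q c a)\<^sup>2 = ((1 - A) * q c a)\<^sup>2 * (s\<^sup>2) ^ 3"
    by (simp add: A_def power_mult_distrib power_mult[symmetric])
  also have "\<dots> \<le> ((5 + 4 * g)\<^sup>2 / 24)\<^sup>2 * (1 - g) ^ 3"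
    unfolding g(3) using le nn g by (intro mult_right_mono power_mono) auto
  \<comment> \<open>Both bases are scaled to equal 1 at \<open>g = 1 / 28\<close>; then 4 times the
    first plus 3 times the second is 7 for every \<open>g\<close>, and the remaining constant is
    \<open>M\<^sup>2\<close>.\<close>
  also have "\<dots> = (7 * (5 + 4 * g) / 36) ^ 4 * (28 * (1 - g) / 27) ^ 3 * (3 ^ 15 / (16 * 7 ^ 7))"
  proof -
    have "(u\<^sup>2 / 24)\<^sup>2 * v ^ 3 = (7 * u / 36) ^ 4 * (28 * v / 27) ^ 3 * (3 ^ 15 / (16 * 7 ^ 7))" for u v :: real
      by (simp add: power_divide power_mult_distrib power_mult[symmetric])
    thus ?thesis .
  qed
  also have "\<dots> \<le> 1 * (3 ^ 15 / (16 * 7 ^ 7))"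
    using g by (intro mult_right_mono am_gm_7) (auto simp: field_simps)
  finally have "((1 - a\<^sup>2) * s ^ 3 * q c a)\<^sup>2 \<le> M\<^sup>2" by (simp add: M_square)
  thus ?thesis using M_nonneg by (rule power2_le_imp_le)
qed

section \<open>Maxima of one-variable polynomials and their numerical consequences\<close>

text \<open>The maximum is at \<open>x = 1 / 3\<close>, so the gap has a double zero there and a
  cofactor that is positive for \<open>x \<ge> 0\<close>. \<open>quartic_bound\<close> works alike
  with \<open>x = 1 / 2\<close>.\<close>

lemma cubic_bound:
  fixes x :: real
  assumes "0 \<le> x"
  shows "(1 - x) * (1 + x)\<^sup>2 \<le> 32 / 27"
proof -
  have "0 \<le> (x - 1/3)\<^sup>2 * (x + 5/3)" using assms by simp
  also have "\<dots> = 32 / 27 - (1 - x) * (1 + x)\<^sup>2"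
    by (simp add: power2_eq_square field_simps)
  finally show ?thesis by simp
qed

lemma quartic_bound:
  fixes x :: real
  assumes "0 \<le> x"
  shows "(1 - x) * (1 + x) ^ 3 \<le> 27 / 16"
proof -
  have "0 \<le> (x - 1/2)\<^sup>2 * (x\<^sup>2 + 3 * x + 11/4)" using assms by simp
  also have "\<dots> = 27 / 16 - (1 - x) * (1 + x) ^ 3"
    by (simp add: power2_eq_square power3_eq_cube field_simps)
  finally show ?thesis by simp
qed

text \<open>The square is \<open>(1 - g) * (1 + g) ^ 3\<close>, and 13/10 is slightly above the root
  of 27/16.\<close>

lemma sin_bound:
  fixes g s :: real
  assumes "g\<^sup>2 + s\<^sup>2 = 1" "0 \<le> s" "0 \<le> g"
  shows "s * (1 + g) \<le> 13 / 10"
proof -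
  have "(s * (1 + g))\<^sup>2 = (1 - g\<^sup>2) * (1 + g)\<^sup>2" using assms(1) by (simp add: power_mult_distrib)
  also have "\<dots> = (1 - g) * (1 + g) ^ 3" by (simp add: power2_eq_square power3_eq_cube algebra_simps)
  also have "\<dots> \<le> 27 / 16" using quartic_bound assms by simp
  also have "\<dots> \<le> (13 / 10)\<^sup>2" by (simp add: power2_eq_square)
  finally show ?thesis by (rule power2_le_imp_le) simp
qed

lemma sin_bound_large:
  fixes g s :: real
  assumes "g\<^sup>2 + s\<^sup>2 = 1" "0 \<le> s" "7 / 10 \<le> g"
  shows "s * (1 + g) \<le> 1215 / 1000"
proof -
  have sq: "(7/10)\<^sup>2 \<le> g\<^sup>2" using assms(3) by (intro power_mono) auto
  \<comment> \<open>Both factors of the gap in \<open>quartic_bound\<close> are evaluated at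
    \<open>g = 7 / 10\<close>: \<open>1/5 = 7/10 - 1/2\<close>, and 534/100 is the value of the
    second factor.\<close>
  have "(1/5)\<^sup>2 * (534/100) \<le> (g - 1/2)\<^sup>2 * (g\<^sup>2 + 3 * g + 11/4)"
    using assms(3) sq by (intro mult_mono power_mono) (auto simp: power2_eq_square)
  moreover have "(g - 1/2)\<^sup>2 * (g\<^sup>2 + 3 * g + 11/4) = 27 / 16 - (1 - g) * (1 + g) ^ 3"
    by (simp add: power2_eq_square power3_eq_cube field_simps)
  ultimately have "(1 - g) * (1 + g) ^ 3 \<le> (1215 / 1000)\<^sup>2" by (simp add: power2_eq_square)
  moreover have "(s * (1 + g))\<^sup>2 = (1 - g\<^sup>2) * (1 + g)\<^sup>2" using assms(1) by (simp add: power_mult_distrib)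
  moreover have "\<dots> = (1 - g) * (1 + g) ^ 3" by (simp add: power2_eq_square power3_eq_cube algebra_simps)
  ultimately have "(s * (1 + g))\<^sup>2 \<le> (1215 / 1000)\<^sup>2" by simp
  thus ?thesis by (rule power2_le_imp_le) simp
qed

lemma unit_bounds:
  fixes c s :: real
  assumes "c\<^sup>2 + s\<^sup>2 = 1" "0 \<le> s"
  shows "\<bar>c\<bar> \<le> 1" "s \<le> 1" "s\<^sup>2 = 1 - c\<^sup>2"
proof -
  have "c\<^sup>2 \<le> 1" "s\<^sup>2 \<le> 1" using assms zero_le_power2[of c] zero_le_power2[of s] by linarith+
  thus "\<bar>c\<bar> \<le> 1" "s \<le> 1" by (simp_all add: abs_square_le_1)
  show "s\<^sup>2 = 1 - c\<^sup>2" using assms by simp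
qed

text \<open>The separate maxima 13/10 and 27/16 would give \<open>2 * (13/10) * (27/16)\<close>,
  which exceeds \<open>4 * M\<close>. Splitting at \<open>\<bar>c\<bar> = 7 / 10\<close> helps:
  below it \<open>X\<close> is smaller, above it \<open>s * (1 + \<bar>c\<bar>)\<close> is past its
  peak at \<open>\<bar>c\<bar> = 1 / 2\<close>.\<close>

lemma weight_bound:
  fixes c s X :: real
  assumes u: "c\<^sup>2 + s\<^sup>2 = 1" "0 \<le> s"
    and small: "\<bar>c\<bar> \<le> 7 / 10 \<Longrightarrow> X \<le> 16 / 10"
    and large: "X \<le> 27 / 16"
  shows "s * (2 + 2 * \<bar>c\<bar>) * X \<le> 417 / 100"
proof -
  have u': "\<bar>c\<bar>\<^sup>2 + s\<^sup>2 = 1" using u by simp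
  show ?thesis
  proof (cases "\<bar>c\<bar> \<le> 7 / 10")
    case True
    have "s * (1 + \<bar>c\<bar>) * X \<le> s * (1 + \<bar>c\<bar>) * (16 / 10)"
      using small[OF True] u by (intro mult_left_mono) auto
    also have "\<dots> \<le> 13 / 10 * (16 / 10)"
      using sin_bound[OF u' u(2)] by (intro mult_right_mono) auto
    finally show ?thesis by (simp add: algebra_simps)
  next
    case False
    have "s * (1 + \<bar>c\<bar>) * X \<le> s * (1 + \<bar>c\<bar>) * (27 / 16)"
      using large u by (intro mult_left_mono) auto
    also have "\<dots> \<le> 1215 / 1000 * (27 / 16)"
      using sin_bound_large[OF u' u(2)] False by (intro mult_right_mono) auto
    finally show ?thesis by (simp add: algebra_simps)
  qed
qed

section \<open>Pushing two of the reals to the ends of their range\<close>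

text \<open>Covers the configurations in which at most one further real sits on the circle:
  \<open>2 + 2 * \<bar>c\<bar>\<close> dominates 1 and both \<open>2 + 2 * c\<close> and
  \<open>2 - 2 * c\<close>.\<close>

lemma side_bound:
  assumes u: "c\<^sup>2 + s\<^sup>2 = 1" "0 \<le> s" and a: "\<bar>a\<bar> \<le> 1"
  shows "s * (2 + 2 * \<bar>c\<bar>) * ((1 - a\<^sup>2) * q c a) \<le> 417 / 100"
proof (rule weight_bound[OF u])
  define A where "A = a\<^sup>2"
  define g where "g = \<bar>c\<bar>"
  have A: "0 \<le> A" "A \<le> 1" using a by (simp_all add: A_def abs_square_le_1)
  show "(1 - a\<^sup>2) * q c a \<le> 16 / 10" if "\<bar>c\<bar> \<le> 7 / 10"
  proof -
    \<comment> \<open>Splits the cross term: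
      \<open>2 * g * \<bar>a\<bar> \<le> g\<^sup>2 + A\<close>.\<close>
    have "0 \<le> (g - \<bar>a\<bar>)\<^sup>2" by simp
    hence "q c a \<le> 1 + 2 * A + g\<^sup>2"
      using q_le_abs[of c a] by (simp add: A_def g_def power2_eq_square algebra_simps)
    moreover have "g\<^sup>2 \<le> (7 / 10)\<^sup>2" using that unfolding g_def by (intro power_mono) auto
    ultimately have "q c a \<le> 149 / 100 + 2 * A" by (simp add: power2_eq_square)
    hence "(1 - A) * q c a \<le> (1 - A) * (149 / 100 + 2 * A)" using A by (intro mult_left_mono) auto
    also have "\<dots> \<le> 16 / 10"
    proof -
      \<comment> \<open>The quadratic in \<open>A\<close> has its vertex at 51/400; the nearby value
        1/8 is accurate enough.\<close>
      have "0 \<le> (A - 1 / 8)\<^sup>2" by simp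
      thus ?thesis using A by (simp add: power2_eq_square field_simps)
    qed
    finally show ?thesis by (simp add: A_def)
  qed
  show "(1 - a\<^sup>2) * q c a \<le> 27 / 16"
  proof -
    have "(1 - a\<^sup>2) * q c a \<le> (1 - a\<^sup>2) * (1 + \<bar>a\<bar>)\<^sup>2"
      using a unit_bounds(1)[OF u] by (intro mult_left_mono q_le_square) (auto simp: abs_square_le_1)
    also have "\<dots> = (1 - \<bar>a\<bar>\<^sup>2) * (1 + \<bar>a\<bar>)\<^sup>2" by simp
    also have "\<dots> = (1 - \<bar>a\<bar>) * (1 + \<bar>a\<bar>) ^ 3"
      by (simp only: power2_eq_square power3_eq_cube) (simp add: algebra_simps)
    also have "\<dots> \<le> 27 / 16" by (rule quartic_bound) simp
    finally show ?thesis .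
  qed
qed

lemma K_le_M: "417 / 100 \<le> 4 * M"
  using M_lower by simp

text \<open>Convexity pushes \<open>x\<close> to -1 or 0 and \<open>y\<close> to 0 or 1. Only
  \<open>x = - 1\<close>, \<open>y = 1\<close> needs \<open>core_bound\<close>, through
  \<open>(2 + 2 * c) * (2 - 2 * c) = 4 * s\<^sup>2\<close>; otherwise at most one of the two factors
  differs from 1 and \<open>side_bound\<close> suffices.\<close>

lemma opposite_bound:
  assumes u: "c\<^sup>2 + s\<^sup>2 = 1" "0 \<le> s" and a: "\<bar>a\<bar> \<le> 1"
    and x: "- 1 \<le> x" "x \<le> 0" and y: "0 \<le> y" "y \<le> 1"
  shows "(1 - a\<^sup>2) * s * q c a * q c x * q c y \<le> 4 * M"
proof -
  note c = unit_bounds[OF u]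
  define F where "F = (1 - a\<^sup>2) * s * q c a"
  have F0: "0 \<le> F" using a u q_nonneg[OF c(1)] by (simp add: F_def abs_square_le_1)
  have side: "F * t \<le> 4 * M" if "t \<le> 2 + 2 * \<bar>c\<bar>" for t
  proof -
    have "F * t \<le> F * (2 + 2 * \<bar>c\<bar>)" using F0 that by (rule mult_left_mono[rotated])
    also have "\<dots> \<le> 417 / 100" using side_bound[OF u a] by (simp add: F_def mult_ac)
    finally show ?thesis using K_le_M by simp
  qed
  have core: "F * ((2 + 2 * c) * (2 - 2 * c)) \<le> 4 * M"
  proof -
    have "(2 + 2 * c) * (2 - 2 * c) = 4 * s\<^sup>2"
      unfolding c(3) by (simp add: power2_eq_square algebra_simps)
    hence "F * ((2 + 2 * c) * (2 - 2 * c)) = 4 * ((1 - a\<^sup>2) * s ^ 3 * q c a)"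
      by (simp add: F_def power2_eq_square power3_eq_cube mult_ac)
    thus ?thesis using core_bound[OF u a] by simp
  qed
  have "q c x * q c y \<le> max 1 (2 + 2 * c) * max 1 (2 - 2 * c)"
    using x y q_nonneg[OF c(1)] by (intro mult_mono q_le_max_pos q_le_max_neg) auto
  hence "F * (q c x * q c y) \<le> F * (max 1 (2 + 2 * c) * max 1 (2 - 2 * c))"
    using F0 by (rule mult_left_mono)
  also have "\<dots> \<le> 4 * M"
    using side[of 1] side[of "2 + 2 * c"] side[of "2 - 2 * c"] core
    by (auto simp: max_def)
  finally show ?thesis by (simp add: F_def mult_ac)
qed

text \<open>For a fixed product \<open>p = b * e\<close>, \<open>q c b * q c e\<close> is a convex function of \<open>b + e\<close>; the two terms
  are its values at \<open>b + e = 0\<close> and \<open>b + e = 1 + p\<close>.\<close>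

lemma q_mult_le:
  assumes b: "0 \<le> b" "b \<le> 1" and e: "0 \<le> e" "e \<le> 1"
  shows "q c b * q c e \<le> max ((1 - b * e)\<^sup>2 + 4 * c\<^sup>2 * (b * e)) ((2 - 2 * c) * q c (b * e))"
proof -
  define p where "p = b * e"
  define t where "t = b + e"
  have pr: "q c b * q c e = (1 - p)\<^sup>2 + 4 * c\<^sup>2 * p + t * (t - 2 * c * (1 + p))"
    by (simp add: q_def p_def t_def power2_eq_square algebra_simps)
  have end2: "(2 - 2 * c) * q c p = (1 - p)\<^sup>2 + 4 * c\<^sup>2 * p + (1 + p) * (1 + p - 2 * c * (1 + p))"
    by (simp add: q_def power2_eq_square algebra_simps)
  have t: "0 \<le> t" "t \<le> 1 + p"
  proof -
    have "0 \<le> (1 - b) * (1 - e)" using b e by simp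
    thus "t \<le> 1 + p" by (simp add: t_def p_def algebra_simps)
  qed (use b e in \<open>simp add: t_def\<close>)
  show ?thesis
  proof (cases "t \<le> 2 * c * (1 + p)")
    case True
    hence "t * (t - 2 * c * (1 + p)) \<le> 0" using t by (intro mult_nonneg_nonpos) auto
    thus ?thesis using pr by (simp add: p_def)
  next
    case False
    hence "t * (t - 2 * c * (1 + p)) \<le> (1 + p) * (1 + p - 2 * c * (1 + p))"
      using t by (intro mult_mono) auto
    thus ?thesis using pr end2 by (simp add: p_def)
  qed
qed

text \<open>Supplies the premises of \<open>weight_bound\<close> for the endpoint
  \<open>b + e = 0\<close> of \<open>q_mult_le\<close>.\<close>

lemma endpoint_bounds:
  fixes p c :: real
  assumes p: "0 \<le> p" "p \<le> 1" and c: "\<bar>c\<bar> \<le> 1"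
  defines "X \<equiv> (1 - p\<^sup>2) * ((1 - p)\<^sup>2 + 4 * c\<^sup>2 * p)"
  shows "0 \<le> X" "X \<le> 27 / 16" "\<bar>c\<bar> \<le> 7 / 10 \<Longrightarrow> X \<le> 16 / 10"
proof -
  have p2: "p\<^sup>2 \<le> 1" using p by (simp add: abs_square_le_1)
  show "0 \<le> X" using p p2 unfolding X_def by (intro mult_nonneg_nonneg add_nonneg_nonneg) auto
  have "c\<^sup>2 \<le> 1" using c by (simp add: abs_square_le_1)
  hence "c\<^sup>2 * p \<le> 1 * p" using p by (intro mult_right_mono) auto
  hence "(1 - p)\<^sup>2 + 4 * c\<^sup>2 * p \<le> (1 + p)\<^sup>2" by (simp add: power2_eq_square algebra_simps)
  hence "X \<le> (1 - p\<^sup>2) * (1 + p)\<^sup>2" using p2 unfolding X_def by (intro mult_left_mono) auto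
  also have "\<dots> = (1 - p) * (1 + p) ^ 3" by (simp add: power2_eq_square power3_eq_cube algebra_simps)
  also have "\<dots> \<le> 27 / 16" using p(1) by (rule quartic_bound)
  finally show "X \<le> 27 / 16" .
  show "X \<le> 16 / 10" if "\<bar>c\<bar> \<le> 7 / 10"
  proof -
    have "\<bar>c\<bar>\<^sup>2 \<le> (7/10)\<^sup>2" using that by (intro power_mono) auto
    hence "c\<^sup>2 * p \<le> (7/10)\<^sup>2 * p" using p by (intro mult_right_mono) auto
    \<comment> \<open>\<open>4 * (7/10)\<^sup>2 < 2\<close>, so the term in \<open>c\<close> does
      not outweigh \<open>- 2 * p\<close>.\<close>
    hence "(1 - p)\<^sup>2 + 4 * c\<^sup>2 * p \<le> 1 + p\<^sup>2" using p by (simp add: power2_eq_square algebra_simps)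
    hence "X \<le> (1 - p\<^sup>2) * (1 + p\<^sup>2)" using p2 unfolding X_def by (intro mult_left_mono) auto
    also have "\<dots> = 1 - (p\<^sup>2)\<^sup>2" by (simp add: power2_eq_square algebra_simps)
    finally show ?thesis using zero_le_power2[of "p\<^sup>2"] by linarith
  qed
qed

lemma q_le_extreme:
  assumes "\<bar>c\<bar> \<le> 1" "\<bar>x\<bar> \<le> 1"
  shows "q c x \<le> 2 + 2 * \<bar>c\<bar>"
proof -
  have "\<bar>c\<bar> * \<bar>x\<bar> \<le> \<bar>c\<bar> * 1" using assms by (intro mult_left_mono) auto
  moreover have "x\<^sup>2 \<le> 1" using assms by (simp add: abs_square_le_1)
  ultimately show ?thesis using q_le_abs[of c x] by simp
qed

text \<open>The weight depends on \<open>b\<close> and \<open>e\<close> only through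
  \<open>p = b * e\<close>, so \<open>q_mult_le\<close> applies at fixed \<open>p\<close>. The
  endpoint \<open>b + e = 1 + p\<close> means the pair of values \<open>1\<close>, \<open>p\<close>,
  which is \<open>opposite_bound\<close> with \<open>y = 1\<close>; the endpoint
  \<open>b + e = 0\<close> falls under \<open>weight_bound\<close>.\<close>

lemma same_side_bound:
  assumes u: "c\<^sup>2 + s\<^sup>2 = 1" "0 \<le> s"
    and b: "0 \<le> b" "b \<le> 1" and e: "0 \<le> e" "e \<le> 1" and x: "- 1 \<le> x" "x \<le> 0"
  shows "(1 - (b * e)\<^sup>2) * s * q c b * q c e * q c x \<le> 4 * M"
proof -
  note c = unit_bounds[OF u]
  define p where "p = b * e"
  have p: "0 \<le> p" "p \<le> 1" using b e by (simp_all add: p_def mult_le_one)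
  define F where "F = (1 - p\<^sup>2) * s * q c x"
  have F0: "0 \<le> F" using p u q_nonneg[OF c(1)] by (simp add: F_def abs_square_le_1)
  define X where "X = (1 - p)\<^sup>2 + 4 * c\<^sup>2 * p"
  have "F * (q c b * q c e) \<le> F * max X ((2 - 2 * c) * q c p)"
    using q_mult_le[OF b e, of c] F0 unfolding p_def X_def by (rule mult_left_mono)
  also have "\<dots> \<le> 4 * M"
  proof -
    have "F * ((2 - 2 * c) * q c p) \<le> 4 * M"
      using opposite_bound[OF u, of p x 1] p x by (simp add: F_def q_def mult_ac)
    moreover have "F * X \<le> 4 * M"
    proof -
      note X = endpoint_bounds[OF p c(1), folded X_def]
      have "F * X = s * q c x * ((1 - p\<^sup>2) * X)" by (simp add: F_def)
      also have "\<dots> \<le> s * (2 + 2 * \<bar>c\<bar>) * ((1 - p\<^sup>2) * X)"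
        using q_le_extreme[OF c(1), of x] x u X(1) by (intro mult_right_mono mult_left_mono) auto
      also have "\<dots> \<le> 417 / 100" by (rule weight_bound[OF u X(3) X(2)])
      finally show ?thesis using K_le_M by simp
    qed
    ultimately show ?thesis by (simp add: max_def)
  qed
  finally show ?thesis by (simp add: F_def p_def mult_ac)
qed

section \<open>Pohst-type inequalities for the three reals\<close>

lemma weight_le:
  assumes u: "c\<^sup>2 + s\<^sup>2 = 1" "0 \<le> s" and x: "\<bar>x\<bar> \<le> 1"
  shows "s * q c x \<le> 26 / 10"
proof -
  have "s * q c x \<le> s * (2 + 2 * \<bar>c\<bar>)"
    using q_le_extreme[OF unit_bounds(1)[OF u] x] u(2) by (rule mult_left_mono)
  thus ?thesis using sin_bound[of "\<bar>c\<bar>" s] u by (simp add: algebra_simps)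
qed

text \<open>All reals lie in the closed unit disc. If their signs are mixed, the differences are at
  most \<open>2 * (b * d\<^sup>2) * (1 - v)\<close>, with \<open>v\<close> the square of a real
  chosen so that the other two lie on opposite sides of 0; then \<open>opposite_bound\<close>
  applies.\<close>

lemma outer_pair_aux:
  assumes u: "c\<^sup>2 + s\<^sup>2 = 1" "0 \<le> s"
    and b: "0 < b" "\<bar>a\<bar> \<le> b" "b \<le> \<bar>d\<bar>" "\<bar>d\<bar> \<le> 1"
  shows "\<bar>a - b\<bar> * \<bar>a - d\<bar> * \<bar>b - d\<bar> * (s * q c a * q c b * q c d) \<le> 8 * M * (b * d\<^sup>2)"
proof -
  note c = unit_bounds[OF u]
  define S where "S = s * q c a * q c b * q c d"
  have S0: "0 \<le> S" using u q_nonneg[OF c(1)] by (simp add: S_def)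
  have close: ?thesis
    if "\<bar>a - b\<bar> * \<bar>a - d\<bar> * \<bar>b - d\<bar> \<le> 2 * (b * d\<^sup>2) * (1 - v)" "(1 - v) * S \<le> 4 * M" for v
  proof -
    have "\<bar>a - b\<bar> * \<bar>a - d\<bar> * \<bar>b - d\<bar> * S \<le> 2 * (b * d\<^sup>2) * (1 - v) * S"
      using that(1) S0 by (rule mult_right_mono)
    also have "\<dots> = 2 * (b * d\<^sup>2) * ((1 - v) * S)" by simp
    also have "\<dots> \<le> 2 * (b * d\<^sup>2) * (4 * M)" using that(2) b by (intro mult_left_mono) auto
    finally show ?thesis by (simp add: S_def mult_ac)
  qed
  consider "d < 0" | "0 < d" "a < 0" | "0 < d" "0 \<le> a" using b by linarith
  thus ?thesis
  proof cases
    case 1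
    show ?thesis
    proof (rule close[of "a\<^sup>2"])
      have "\<bar>a - b\<bar> * \<bar>b - d\<bar> \<le> 2 * b * (- d - a)"
      proof -
        \<comment> \<open>This product is the left side of the claim minus its right side.\<close>
        have "(b + d) * (b + a) \<le> 0" using 1 b by (intro mult_nonpos_nonneg) auto
        moreover have "\<bar>a - b\<bar> = b - a" "\<bar>b - d\<bar> = b - d" using 1 b by auto
        ultimately show ?thesis by (simp add: algebra_simps)
      qed
      hence "\<bar>a - b\<bar> * \<bar>b - d\<bar> * \<bar>a - d\<bar> \<le> 2 * b * (- d - a) * \<bar>a - d\<bar>"
        by (rule mult_right_mono) simp
      also have "\<dots> = 2 * b * (d\<^sup>2 - a\<^sup>2)"
      proof -
        have "\<bar>a - d\<bar> = a - d" using 1 b by auto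
        thus ?thesis by (simp add: power2_eq_square algebra_simps)
      qed
      also have "\<dots> \<le> 2 * b * (d\<^sup>2 * (1 - a\<^sup>2))"
      proof (intro mult_left_mono)
        have "d\<^sup>2 * a\<^sup>2 \<le> 1 * a\<^sup>2" using b by (intro mult_right_mono) (auto simp: abs_square_le_1)
        thus "d\<^sup>2 - a\<^sup>2 \<le> d\<^sup>2 * (1 - a\<^sup>2)" by (simp add: algebra_simps)
      qed (use b in auto)
      finally show "\<bar>a - b\<bar> * \<bar>a - d\<bar> * \<bar>b - d\<bar> \<le> 2 * (b * d\<^sup>2) * (1 - a\<^sup>2)" by (simp add: mult_ac)
      show "(1 - a\<^sup>2) * S \<le> 4 * M"
        using opposite_bound[OF u, of a d b] 1 b by (simp add: S_def mult_ac)
    qed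
  next
    case 2
    show ?thesis
    proof (rule close[of "b\<^sup>2"])
      have "\<bar>a - b\<bar> * \<bar>a - d\<bar> * \<bar>b - d\<bar> = (b - a) * (d - a) * (d - b)"
        using 2 b by (simp add: abs_if)
      also have "\<dots> \<le> (2 * b) * (d + b) * (d - b)"
        using 2 b by (intro mult_right_mono mult_mono) auto
      also have "\<dots> = 2 * b * (d\<^sup>2 - b\<^sup>2)" by (simp add: power2_eq_square algebra_simps)
      also have "\<dots> \<le> 2 * b * (d\<^sup>2 * (1 - b\<^sup>2))"
      proof (intro mult_left_mono)
        have "d\<^sup>2 * b\<^sup>2 \<le> 1 * b\<^sup>2" using b by (intro mult_right_mono) (auto simp: abs_square_le_1)
        thus "d\<^sup>2 - b\<^sup>2 \<le> d\<^sup>2 * (1 - b\<^sup>2)" by (simp add: algebra_simps)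
      qed (use b in auto)
      finally show "\<bar>a - b\<bar> * \<bar>a - d\<bar> * \<bar>b - d\<bar> \<le> 2 * (b * d\<^sup>2) * (1 - b\<^sup>2)" by (simp add: mult_ac)
      show "(1 - b\<^sup>2) * S \<le> 4 * M"
        using opposite_bound[OF u, of b a d] 2 b by (simp add: S_def mult_ac)
    qed
  next
    case 3
    \<comment> \<open>For nonnegative reals crude estimates suffice: \<open>(1 - a) * q c a\<close>
      and \<open>(1 - b) * q c b\<close> are at most 32/27 each, and \<open>s * q c d\<close> is at
      most 26/10.\<close>
    have qa: "q c a \<le> (1 + a)\<^sup>2" "q c b \<le> (1 + b)\<^sup>2" using 3 b c(1) by (auto intro: q_le_square)
    have "\<bar>a - b\<bar> * \<bar>a - d\<bar> * \<bar>b - d\<bar> = (b - a) * d * (d - b) - (b - a) * a * (d - b)"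
      using 3 b by (simp add: abs_if algebra_simps)
    also have "\<dots> \<le> (b - a) * d * (d - b)" using 3 b by simp
    also have "\<dots> \<le> (b * (1 - a)) * d * (d * (1 - b))"
    proof (intro mult_mono)
      show "b - a \<le> b * (1 - a)" using 3 b mult_right_mono[of b 1 a] by (simp add: algebra_simps)
      show "d - b \<le> d * (1 - b)" using 3 b mult_right_mono[of d 1 b] by (simp add: algebra_simps)
    qed (use 3 b in auto)
    finally have D: "\<bar>a - b\<bar> * \<bar>a - d\<bar> * \<bar>b - d\<bar> \<le> (b * d\<^sup>2) * ((1 - a) * (1 - b))"
      by (simp add: power2_eq_square mult_ac)
    have "(1 - a) * (1 - b) * S = ((1 - a) * q c a) * ((1 - b) * q c b) * (s * q c d)"
      by (simp add: S_def mult_ac)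
    also have "\<dots> \<le> ((1 - a) * (1 + a)\<^sup>2) * ((1 - b) * (1 + b)\<^sup>2) * (s * q c d)"
      using qa 3 b u q_nonneg[OF c(1)] by (intro mult_right_mono mult_mono mult_left_mono) auto
    also have "\<dots> \<le> (32 / 27) * (32 / 27) * (26 / 10)"
      using weight_le[OF u] 3 b u q_nonneg[OF c(1)] by (intro mult_mono cubic_bound) auto
    also have "\<dots> \<le> 8 * M" using K_le_M by simp
    finally have S: "(1 - a) * (1 - b) * S \<le> 8 * M" .
    have "\<bar>a - b\<bar> * \<bar>a - d\<bar> * \<bar>b - d\<bar> * S \<le> (b * d\<^sup>2) * ((1 - a) * (1 - b)) * S"
      using D S0 by (rule mult_right_mono)
    also have "\<dots> = (b * d\<^sup>2) * ((1 - a) * (1 - b) * S)" by simp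
    also have "\<dots> \<le> (b * d\<^sup>2) * (8 * M)" using S b by (intro mult_left_mono) auto
    finally show ?thesis by (simp add: S_def mult_ac)
  qed
qed

lemma outer_pair:
  assumes u: "c\<^sup>2 + s\<^sup>2 = 1" "0 \<le> s"
    and b: "b \<noteq> 0" "\<bar>a\<bar> \<le> \<bar>b\<bar>" "\<bar>b\<bar> \<le> \<bar>d\<bar>" "\<bar>d\<bar> \<le> 1"
  shows "\<bar>a - b\<bar> * \<bar>a - d\<bar> * \<bar>b - d\<bar> * (s * q c a * q c b * q c d) \<le> 8 * M * (\<bar>b\<bar> * d\<^sup>2)"
proof (cases "0 < b")
  case True
  thus ?thesis using outer_pair_aux[OF u, of b a d] b by simp
next
  case False
  have "(- c)\<^sup>2 + s\<^sup>2 = 1" using u by simp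
  from outer_pair_aux[OF this u(2), of "- b" "- a" "- d"] show ?thesis
    using b False by (simp add: q_minus abs_minus_commute)
qed

text \<open>Here \<open>e\<close> stands for the inverse of a real outside the circle, so
  \<open>1 - a * e\<close> comes from the difference of \<open>a\<close> and \<open>1 / e\<close>.
  The sign pattern decides which square \<open>v\<close> to take: \<open>a\<^sup>2\<close> with
  \<open>opposite_bound\<close>, or the square of the product of \<open>e\<close> and the real on
  its side with \<open>same_side_bound\<close>.\<close>

lemma inner_pair_aux:
  assumes u: "c\<^sup>2 + s\<^sup>2 = 1" "0 \<le> s"
    and b: "0 < b" "\<bar>a\<bar> \<le> b" "b \<le> 1" and e: "\<bar>e\<bar> \<le> 1"
  shows "\<bar>a - b\<bar> * (1 - a * e) * (1 - b * e) * (s * q c a * q c b * q c e) \<le> 8 * M * b"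
proof -
  note c = unit_bounds[OF u]
  define S where "S = s * q c a * q c b * q c e"
  have S0: "0 \<le> S" using u q_nonneg[OF c(1)] by (simp add: S_def)
  have ae: "\<bar>a * e\<bar> \<le> 1" "\<bar>b * e\<bar> \<le> 1" using b e by (auto simp: abs_mult intro: mult_le_one)
  have close: ?thesis
    if "\<bar>a - b\<bar> * (1 - a * e) * (1 - b * e) \<le> 2 * b * (1 - v)" "(1 - v) * S \<le> 4 * M" for v
  proof -
    have "\<bar>a - b\<bar> * (1 - a * e) * (1 - b * e) * S \<le> 2 * b * (1 - v) * S"
      using that(1) S0 by (rule mult_right_mono)
    also have "\<dots> = 2 * b * ((1 - v) * S)" by simp
    also have "\<dots> \<le> 2 * b * (4 * M)" using that(2) b by (intro mult_left_mono) auto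
    finally show ?thesis by (simp add: S_def mult_ac)
  qed
  consider "0 \<le> a" "0 \<le> e" | "0 \<le> a" "e < 0" | "a < 0" "0 \<le> e" | "a < 0" "e < 0" by linarith
  thus ?thesis
  proof cases
    case 1
    define p where "p = b * e"
    have p: "0 \<le> p" "p \<le> 1" using ae b 1 by (auto simp: p_def)
    have qa: "q c a \<le> (1 + a)\<^sup>2" "q c b \<le> (1 + b)\<^sup>2" "q c e \<le> (1 + e)\<^sup>2"
      using 1 b c(1) by (auto intro: q_le_square)
    have "\<bar>a - b\<bar> * (1 - a * e) \<le> (b * (1 - a)) * 1"
    proof (intro mult_mono)
      show "\<bar>a - b\<bar> \<le> b * (1 - a)" using 1 b mult_right_mono[of b 1 a] by (simp add: algebra_simps)
    qed (use 1 b ae in auto)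
    hence "\<bar>a - b\<bar> * (1 - a * e) * (1 - b * e) \<le> (b * (1 - a)) * 1 * (1 - b * e)"
      using ae by (intro mult_right_mono) auto
    hence D: "\<bar>a - b\<bar> * (1 - a * e) * (1 - b * e) \<le> b * ((1 - a) * (1 - p))" by (simp add: p_def)
    \<comment> \<open>Reduces the factors of \<open>b\<close> and \<open>e\<close> to the single
      variable \<open>p\<close>, so that \<open>cubic_bound\<close> can be used for both
      \<open>a\<close> and \<open>p\<close>.\<close>
    have be: "(1 + b) * (1 + e) \<le> 2 * (1 + p)"
    proof -
      have "0 \<le> (1 - b) * (1 - e)" using b e by simp
      thus ?thesis by (simp add: p_def algebra_simps)
    qed
    have "(1 - a) * (1 - p) * S = ((1 - a) * q c a) * ((1 - p) * (q c b * q c e)) * s"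
      by (simp add: S_def mult_ac)
    also have "\<dots> \<le> ((1 - a) * (1 + a)\<^sup>2) * ((1 - p) * ((1 + b)\<^sup>2 * (1 + e)\<^sup>2)) * 1"
      using qa 1 b p u c q_nonneg[OF c(1)] by (intro mult_mono) auto
    also have "\<dots> = ((1 - a) * (1 + a)\<^sup>2) * ((1 - p) * ((1 + b) * (1 + e))\<^sup>2)"
      by (simp add: power_mult_distrib)
    also have "\<dots> \<le> ((1 - a) * (1 + a)\<^sup>2) * ((1 - p) * (2 * (1 + p))\<^sup>2)"
      using be 1 b p by (intro mult_left_mono power_mono) auto
    also have "\<dots> = 4 * (((1 - a) * (1 + a)\<^sup>2) * ((1 - p) * (1 + p)\<^sup>2))"
      by (simp add: power_mult_distrib del: distrib_left_numeral)
    also have "\<dots> \<le> 4 * ((32 / 27) * (32 / 27))"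
      using 1 b p by (intro mult_left_mono mult_mono cubic_bound) auto
    also have "\<dots> \<le> 8 * M" using K_le_M by simp
    finally have S: "(1 - a) * (1 - p) * S \<le> 8 * M" .
    have "\<bar>a - b\<bar> * (1 - a * e) * (1 - b * e) * S \<le> b * ((1 - a) * (1 - p)) * S"
      using D S0 by (rule mult_right_mono)
    also have "\<dots> = b * ((1 - a) * (1 - p) * S)" by simp
    also have "\<dots> \<le> b * (8 * M)" using S b by (intro mult_left_mono) auto
    finally show ?thesis by (simp add: S_def mult_ac)
  next
    case 2
    show ?thesis
    proof (rule close[of "a\<^sup>2"])
      have "\<bar>a - b\<bar> * (1 - b * e) \<le> b * (1 - a) * (1 - e)"
      proof -
        \<comment> \<open>This product is the right side of the claim minus its left side.\<close>
        have "0 \<le> (1 - b) * (a - b * e)" using 2 b mult_nonneg_nonpos[of b e] by (intro mult_nonneg_nonneg) auto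
        moreover have "\<bar>a - b\<bar> = b - a" using 2 b by auto
        ultimately show ?thesis by (simp add: algebra_simps)
      qed
      hence "\<bar>a - b\<bar> * (1 - b * e) * (1 - a * e) \<le> b * (1 - a) * (1 - e) * (1 - a * e)"
        using ae by (intro mult_right_mono) auto
      also have "\<dots> \<le> b * (1 - a) * 2 * (1 + a)"
      proof (intro mult_mono)
        show "1 - a * e \<le> 1 + a" using 2 e mult_left_mono[of "- e" 1 a] by simp
      qed (use 2 b e ae in auto)
      finally show "\<bar>a - b\<bar> * (1 - a * e) * (1 - b * e) \<le> 2 * b * (1 - a\<^sup>2)"
        by (simp add: power2_eq_square algebra_simps)
      show "(1 - a\<^sup>2) * S \<le> 4 * M"
        using opposite_bound[OF u, of a e b] 2 b e by (simp add: S_def mult_ac)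
    qed
  next
    case 3
    show ?thesis
    proof (rule close[of "(b * e)\<^sup>2"])
      have "\<bar>a - b\<bar> * (1 - a * e) \<le> (2 * b) * (1 + b * e)"
      proof (intro mult_mono)
        show "1 - a * e \<le> 1 + b * e" using 3 b mult_right_mono[of "- a" b e] by simp
      qed (use 3 b ae in auto)
      hence "\<bar>a - b\<bar> * (1 - a * e) * (1 - b * e) \<le> (2 * b) * (1 + b * e) * (1 - b * e)"
        using ae by (intro mult_right_mono) auto
      also have "\<dots> = 2 * b * (1 - (b * e)\<^sup>2)" by (simp add: power2_eq_square algebra_simps)
      finally show "\<bar>a - b\<bar> * (1 - a * e) * (1 - b * e) \<le> 2 * b * (1 - (b * e)\<^sup>2)" .
      show "(1 - (b * e)\<^sup>2) * S \<le> 4 * M"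
        using same_side_bound[OF u, of b e a] 3 b e by (simp add: S_def mult_ac)
    qed
  next
    case 4
    \<comment> \<open>\<open>a\<close> and \<open>e\<close> are negative; after reflection they lie
      on the nonnegative side, as \<open>same_side_bound\<close> requires.\<close>
    have u': "(- c)\<^sup>2 + s\<^sup>2 = 1" using u by simp
    show ?thesis
    proof (rule close[of "(a * e)\<^sup>2"])
      have "\<bar>a - b\<bar> * (1 - b * e) \<le> 2 * b * (1 + a * e)"
      proof -
        \<comment> \<open>Again the left side of the claim minus its right side.\<close>
        have "(b + a) * (- (b * e) - 1) \<le> 0" using 4 b ae by (intro mult_nonneg_nonpos) auto
        thus ?thesis using 4 b by (simp add: abs_if algebra_simps)
      qed
      hence "\<bar>a - b\<bar> * (1 - b * e) * (1 - a * e) \<le> 2 * b * (1 + a * e) * (1 - a * e)"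
        using ae by (intro mult_right_mono) auto
      also have "\<dots> = 2 * b * (1 - (a * e)\<^sup>2)" by (simp add: power2_eq_square algebra_simps)
      finally show "\<bar>a - b\<bar> * (1 - a * e) * (1 - b * e) \<le> 2 * b * (1 - (a * e)\<^sup>2)" by (simp add: mult_ac)
      show "(1 - (a * e)\<^sup>2) * S \<le> 4 * M"
        using same_side_bound[OF u' u(2), of "- a" "- e" "- b"] 4 b e by (simp add: S_def q_minus mult_ac)
    qed
  qed
qed

lemma inner_pair:
  assumes u: "c\<^sup>2 + s\<^sup>2 = 1" "0 \<le> s"
    and b: "b \<noteq> 0" "\<bar>a\<bar> \<le> \<bar>b\<bar>" "\<bar>b\<bar> \<le> 1" and e: "\<bar>e\<bar> \<le> 1"
  shows "\<bar>a - b\<bar> * (1 - a * e) * (1 - b * e) * (s * q c a * q c b * q c e) \<le> 8 * M * \<bar>b\<bar>"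
proof (cases "0 < b")
  case True
  thus ?thesis using inner_pair_aux[OF u, of b a e] b e by simp
next
  case False
  have "(- c)\<^sup>2 + s\<^sup>2 = 1" using u by simp
  from inner_pair_aux[OF this u(2), of "- b" "- a" "- e"] show ?thesis
    using b e False by (simp add: q_minus abs_minus_commute)
qed

section \<open>Scaling and inversion to the unit circle\<close>

text \<open>The absolute value of the Vandermonde product of \<open>z\<close>, \<open>cnj z\<close>, \<open>r1\<close>, \<open>r2\<close>, \<open>r3\<close>, which is the
  numerator of \<open>P\<close>.\<close>

definition vdm :: "complex \<Rightarrow> real \<Rightarrow> real \<Rightarrow> real \<Rightarrow> real" where
  "vdm z r1 r2 r3 = 2 * \<bar>Im z\<bar> * \<bar>r1 - r2\<bar> * \<bar>r1 - r3\<bar> * \<bar>r2 - r3\<bar>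
     * (cmod (of_real r1 - z))\<^sup>2 * (cmod (of_real r2 - z))\<^sup>2 * (cmod (of_real r3 - z))\<^sup>2"

context
  fixes z :: complex and \<rho> c s :: real
  assumes rho: "\<rho> = cmod z" "0 < \<rho>"
    and c: "c = Re z / \<rho>" and s: "s = \<bar>Im z\<bar> / \<rho>"
begin

lemma unit: "c\<^sup>2 + s\<^sup>2 = 1" "0 \<le> s"
proof -
  have "(Re z)\<^sup>2 + (Im z)\<^sup>2 = \<rho>\<^sup>2" using rho by (simp add: cmod_power2)
  thus "c\<^sup>2 + s\<^sup>2 = 1" using rho(2) by (simp add: c s power_divide add_divide_distrib[symmetric])
  show "0 \<le> s" using rho(2) by (simp add: s)
qed

lemma Im_eq: "\<bar>Im z\<bar> = \<rho> * s"
  using rho(2) by (simp add: s)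

lemma dist_eq: "(cmod (of_real r - z))\<^sup>2 = r\<^sup>2 - 2 * r * \<rho> * c + \<rho>\<^sup>2"
proof -
  have "\<rho>\<^sup>2 = (Re z)\<^sup>2 + (Im z)\<^sup>2" using rho by (simp add: cmod_power2)
  moreover have "\<rho> * c = Re z" using rho(2) by (simp add: c)
  ultimately show ?thesis unfolding cmod_power2 by (simp add: power2_eq_square algebra_simps)
qed

lemma dist_inner: "(cmod (of_real (\<rho> * x) - z))\<^sup>2 = \<rho>\<^sup>2 * q c x"
  unfolding dist_eq by (simp add: q_def power2_eq_square algebra_simps)

text \<open>Inversion in the circle of radius \<open>\<rho>\<close> preserves the factor
  \<open>q c x\<close> and changes only the scale.\<close>

lemma dist_outer: "x \<noteq> 0 \<Longrightarrow> (cmod (of_real (\<rho> / x) - z))\<^sup>2 = (\<rho> * (1 / \<bar>x\<bar>))\<^sup>2 * q c x"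
  unfolding dist_eq by (simp add: q_def power2_eq_square field_simps)

text \<open>\<open>vdm_last\<close>, \<open>vdm_third\<close>, \<open>vdm_second\<close> and
  \<open>vdm_first\<close> treat 0, 1, 2 and 3 reals outside the circle. On the right each modulus
  has its position minus one as exponent, with the pair taking two consecutive positions: the
  denominator of \<open>P\<close>.\<close>

lemma vdm_last:
  assumes "r2 \<noteq> 0" "\<bar>r1\<bar> \<le> \<bar>r2\<bar>" "\<bar>r2\<bar> \<le> \<bar>r3\<bar>" "\<bar>r3\<bar> \<le> \<rho>"
  shows "vdm z r1 r2 r3 \<le> 16 * M * (\<bar>r2\<bar> * \<bar>r3\<bar>\<^sup>2 * \<rho> ^ 3 * \<rho> ^ 4)"
proof -
  define a where "a = r1 / \<rho>"
  define b where "b = r2 / \<rho>"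
  define d where "d = r3 / \<rho>"
  have r: "r1 = \<rho> * a" "r2 = \<rho> * b" "r3 = \<rho> * d" using rho(2) by (simp_all add: a_def b_def d_def)
  have bnd: "\<bar>a - b\<bar> * \<bar>a - d\<bar> * \<bar>b - d\<bar> * (s * q c a * q c b * q c d) \<le> 8 * M * (\<bar>b\<bar> * d\<^sup>2)"
    using assms rho(2) unfolding r by (intro outer_pair unit) (auto simp: abs_mult)
  have diff: "\<bar>\<rho> * x - \<rho> * y\<bar> = \<rho> * \<bar>x - y\<bar>" for x y
    using rho(2) by (simp add: right_diff_distrib[symmetric] abs_mult)
  have "vdm z r1 r2 r3
      = 2 * \<rho> ^ 10 * (\<bar>a - b\<bar> * \<bar>a - d\<bar> * \<bar>b - d\<bar> * (s * q c a * q c b * q c d))"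
    unfolding vdm_def r dist_inner Im_eq diff by algebra
  also have "\<dots> \<le> 2 * \<rho> ^ 10 * (8 * M * (\<bar>b\<bar> * d\<^sup>2))"
    using bnd rho(2) by (intro mult_left_mono) auto
  also have "\<dots> = 16 * M * (\<bar>r2\<bar> * \<bar>r3\<bar>\<^sup>2 * \<rho> ^ 3 * \<rho> ^ 4)"
    using rho(2) unfolding r abs_mult by (simp add: eval_nat_numeral mult_ac)
  finally show ?thesis .
qed

lemma vdm_third:
  assumes "r2 \<noteq> 0" "\<bar>r1\<bar> \<le> \<bar>r2\<bar>" "\<bar>r2\<bar> \<le> \<rho>" "\<rho> \<le> \<bar>r3\<bar>"
  shows "vdm z r1 r2 r3 \<le> 16 * M * (\<bar>r2\<bar> * \<rho>\<^sup>2 * \<rho> ^ 3 * \<bar>r3\<bar> ^ 4)"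
proof -
  define a where "a = r1 / \<rho>"
  define b where "b = r2 / \<rho>"
  define e where "e = \<rho> / r3"
  have e0: "e \<noteq> 0" using assms rho(2) by (auto simp: e_def)
  have r: "r1 = \<rho> * a" "r2 = \<rho> * b" "r3 = \<rho> / e"
    using rho(2) assms by (simp_all add: a_def b_def e_def)
  have bnds: "b \<noteq> 0" "\<bar>a\<bar> \<le> \<bar>b\<bar>" "\<bar>b\<bar> \<le> 1" "\<bar>e\<bar> \<le> 1"
    using assms rho(2) by (auto simp: a_def b_def e_def divide_simps abs_mult)
  have bnd: "\<bar>a - b\<bar> * (1 - a * e) * (1 - b * e) * (s * q c a * q c b * q c e) \<le> 8 * M * \<bar>b\<bar>"
    using bnds by (intro inner_pair unit)
  \<comment> \<open>A name for the reciprocal makes the following identities polynomial.\<close>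
  define k where "k = 1 / \<bar>e\<bar>"
  have r3: "\<bar>r3\<bar> = \<rho> * k" using rho(2) by (simp add: r k_def)
  have diff: "\<bar>\<rho> * x - \<rho> / e\<bar> = \<rho> * k * (1 - x * e)" if "\<bar>x\<bar> \<le> 1" for x
  proof -
    have "x * e \<le> 1" using that bnds(4) mult_le_one[of "\<bar>x\<bar>" "\<bar>e\<bar>"] abs_ge_self[of "x * e"] by (simp add: abs_mult)
    moreover have "\<rho> * x - \<rho> / e = \<rho> / e * (x * e - 1)" using e0 by (simp add: field_simps)
    ultimately show ?thesis using rho(2) by (simp add: abs_mult k_def)
  qed
  have diff2: "\<bar>\<rho> * a - \<rho> * b\<bar> = \<rho> * \<bar>a - b\<bar>"
    using rho(2) by (simp add: right_diff_distrib[symmetric] abs_mult)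
  have ab: "\<bar>a\<bar> \<le> 1" "\<bar>b\<bar> \<le> 1" using bnds by auto
  have "vdm z r1 r2 r3
      = 2 * \<rho> ^ 10 * k ^ 4 * (\<bar>a - b\<bar> * (1 - a * e) * (1 - b * e) * (s * q c a * q c b * q c e))"
    unfolding vdm_def r dist_inner dist_outer[OF e0] Im_eq diff[OF ab(1)] diff[OF ab(2)] diff2 k_def[symmetric]
    by algebra
  also have "\<dots> \<le> 2 * \<rho> ^ 10 * k ^ 4 * (8 * M * \<bar>b\<bar>)"
    using bnd rho(2) by (intro mult_left_mono) auto
  also have "\<dots> = 16 * M * (\<rho> * \<bar>b\<bar> * \<rho>\<^sup>2 * \<rho> ^ 3 * (\<rho> * k) ^ 4)"
    by algebra
  finally show ?thesis using rho(2) by (simp add: r(2) r3 abs_mult)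
qed

text \<open>Inversion exchanges inside and outside, so two outer reals and one inner real again
  satisfy \<open>inner_pair\<close>.\<close>

lemma vdm_second:
  assumes "\<bar>r1\<bar> \<le> \<rho>" "\<rho> \<le> \<bar>r2\<bar>" "\<bar>r2\<bar> \<le> \<bar>r3\<bar>"
  shows "vdm z r1 r2 r3 \<le> 16 * M * (\<rho> * \<rho>\<^sup>2 * \<bar>r2\<bar> ^ 3 * \<bar>r3\<bar> ^ 4)"
proof -
  define a where "a = \<rho> / r3"
  define b where "b = \<rho> / r2"
  define e where "e = r1 / \<rho>"
  have ab0: "a \<noteq> 0" "b \<noteq> 0" using assms rho(2) by (auto simp: a_def b_def)
  have r: "r1 = \<rho> * e" "r2 = \<rho> / b" "r3 = \<rho> / a"
    using rho(2) assms by (simp_all add: a_def b_def e_def)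
  have bnds: "\<bar>a\<bar> \<le> \<bar>b\<bar>" "\<bar>a\<bar> \<le> 1" "\<bar>b\<bar> \<le> 1" "\<bar>e\<bar> \<le> 1"
    using assms rho(2) by (auto simp: a_def b_def e_def intro!: frac_le)
  have bnd: "\<bar>a - b\<bar> * (1 - a * e) * (1 - b * e) * (s * q c a * q c b * q c e) \<le> 8 * M * \<bar>b\<bar>"
    using bnds ab0 by (intro inner_pair unit)
  define k where "k x = 1 / \<bar>x\<bar>" for x :: real
  have r23: "\<bar>r2\<bar> = \<rho> * k b" "\<bar>r3\<bar> = \<rho> * k a" using rho(2) by (simp_all add: r k_def)
  have kb: "k b * \<bar>b\<bar> = 1" using ab0 by (simp add: k_def)
  have diff: "\<bar>\<rho> * e - \<rho> / x\<bar> = \<rho> * k x * (1 - x * e)" if "x \<noteq> 0" "\<bar>x\<bar> \<le> 1" for x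
  proof -
    have "x * e \<le> 1" using that bnds(4) mult_le_one[of "\<bar>x\<bar>" "\<bar>e\<bar>"] abs_ge_self[of "x * e"] by (simp add: abs_mult)
    moreover have "\<rho> * e - \<rho> / x = \<rho> / x * (x * e - 1)" using that by (simp add: field_simps)
    ultimately show ?thesis using rho(2) by (simp add: abs_mult k_def)
  qed
  have diff2: "\<bar>\<rho> / b - \<rho> / a\<bar> = \<rho> * k a * k b * \<bar>a - b\<bar>"
  proof -
    have "\<rho> / b - \<rho> / a = \<rho> / (a * b) * (a - b)" using ab0 by (simp add: field_simps)
    thus ?thesis using rho(2) by (simp add: abs_mult k_def)
  qed
  have "vdm z r1 r2 r3 = 2 * \<rho> ^ 10 * (k a ^ 4 * k b ^ 4)
        * (\<bar>a - b\<bar> * (1 - a * e) * (1 - b * e) * (s * q c a * q c b * q c e))"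
    unfolding vdm_def r dist_inner dist_outer[OF ab0(1)] dist_outer[OF ab0(2)] Im_eq
      diff[OF ab0(1) bnds(2)] diff[OF ab0(2) bnds(3)] diff2 k_def[symmetric]
    by algebra
  also have "\<dots> \<le> 2 * \<rho> ^ 10 * (k a ^ 4 * k b ^ 4) * (8 * M * \<bar>b\<bar>)"
    using bnd rho(2) by (intro mult_left_mono) auto
  also have "\<dots> = 16 * M * (\<rho> * \<rho>\<^sup>2 * (\<rho> * k b) ^ 3 * (\<rho> * k a) ^ 4)"
    using kb by algebra
  finally show ?thesis unfolding r23 .
qed

lemma vdm_first:
  assumes "\<rho> \<le> \<bar>r1\<bar>" "\<bar>r1\<bar> \<le> \<bar>r2\<bar>" "\<bar>r2\<bar> \<le> \<bar>r3\<bar>"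
  shows "vdm z r1 r2 r3 \<le> 16 * M * (\<rho> * \<bar>r1\<bar>\<^sup>2 * \<bar>r2\<bar> ^ 3 * \<bar>r3\<bar> ^ 4)"
proof -
  define a where "a = \<rho> / r3"
  define b where "b = \<rho> / r2"
  define d where "d = \<rho> / r1"
  have nz: "a \<noteq> 0" "b \<noteq> 0" "d \<noteq> 0" using assms rho(2) by (auto simp: a_def b_def d_def)
  have r: "r1 = \<rho> / d" "r2 = \<rho> / b" "r3 = \<rho> / a"
    using rho(2) assms by (simp_all add: a_def b_def d_def)
  have bnds: "\<bar>a\<bar> \<le> \<bar>b\<bar>" "\<bar>b\<bar> \<le> \<bar>d\<bar>" "\<bar>d\<bar> \<le> 1"
    using assms rho(2) by (auto simp: a_def b_def d_def intro!: frac_le)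
  have bnd: "\<bar>a - b\<bar> * \<bar>a - d\<bar> * \<bar>b - d\<bar> * (s * q c a * q c b * q c d) \<le> 8 * M * (\<bar>b\<bar> * d\<^sup>2)"
    using bnds nz by (intro outer_pair unit)
  define k where "k x = 1 / \<bar>x\<bar>" for x :: real
  have r123: "\<bar>r1\<bar> = \<rho> * k d" "\<bar>r2\<bar> = \<rho> * k b" "\<bar>r3\<bar> = \<rho> * k a"
    using rho(2) by (simp_all add: r k_def)
  \<comment> \<open>These relations cancel the surplus powers: \<open>k b ^ 4\<close> drops to
    exponent 3 and \<open>k d ^ 4\<close> to exponent 2.\<close>
  have kb: "k b * \<bar>b\<bar> = 1" and kd: "(k d)\<^sup>2 * d\<^sup>2 = 1" using nz by (simp_all add: k_def power_divide)
  have diff: "\<bar>\<rho> / x - \<rho> / y\<bar> = \<rho> * k x * k y * \<bar>y - x\<bar>" if "x \<noteq> 0" "y \<noteq> 0" for x y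
  proof -
    have "\<rho> / x - \<rho> / y = \<rho> / (x * y) * (y - x)" using that by (simp add: field_simps)
    thus ?thesis using rho(2) by (simp add: abs_mult k_def)
  qed
  have "vdm z r1 r2 r3 = 2 * \<rho> ^ 10 * (k a ^ 4 * k b ^ 4 * k d ^ 4)
        * (\<bar>a - b\<bar> * \<bar>a - d\<bar> * \<bar>b - d\<bar> * (s * q c a * q c b * q c d))"
    unfolding vdm_def r dist_outer[OF nz(1)] dist_outer[OF nz(2)] dist_outer[OF nz(3)] Im_eq
      diff[OF nz(3) nz(2)] diff[OF nz(3) nz(1)] diff[OF nz(2) nz(1)] k_def[symmetric]
    by algebra
  also have "\<dots> \<le> 2 * \<rho> ^ 10 * (k a ^ 4 * k b ^ 4 * k d ^ 4) * (8 * M * (\<bar>b\<bar> * d\<^sup>2))"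
    using bnd rho(2) by (intro mult_left_mono) auto
  also have "\<dots> = 16 * M * (\<rho> * (\<rho> * k d)\<^sup>2 * (\<rho> * k b) ^ 3 * (\<rho> * k a) ^ 4)"
    using kb kd by algebra
  finally show ?thesis unfolding r123 .
qed

end

section \<open>From \<open>P\<close> to the Vandermonde product\<close>

lemma P_5:
  "P 5 y = cmod (1 - y 1 / y 2) * cmod (1 - y 1 / y 3) * cmod (1 - y 1 / y 4) * cmod (1 - y 1 / y 5)
    * cmod (1 - y 2 / y 3) * cmod (1 - y 2 / y 4) * cmod (1 - y 2 / y 5)
    * cmod (1 - y 3 / y 4) * cmod (1 - y 3 / y 5) * cmod (1 - y 4 / y 5)"
proof -
  have S: "{(i, j). 1 \<le> i \<and> i < j \<and> j \<le> 5} = Sigma {1..5::nat} (\<lambda>i. {i<..5})"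
    by auto
  have I: "{1..5::nat} = {1, 2, 3, 4, 5}" "{1<..5::nat} = {2, 3, 4, 5}" "{2<..5::nat} = {3, 4, 5}"
    "{3<..5::nat} = {4, 5}" "{4<..5::nat} = {5}"
    by auto
  have "P 5 y = (\<Prod>i\<in>{1..5}. \<Prod>j\<in>{i<..5}. cmod (1 - y i / y j))"
    unfolding P_def S by (subst prod.Sigma) auto
  also have "\<dots> = (\<Prod>j\<in>{1<..5}. cmod (1 - y 1 / y j)) * (\<Prod>j\<in>{2<..5}. cmod (1 - y 2 / y j))
      * (\<Prod>j\<in>{3<..5}. cmod (1 - y 3 / y j)) * (\<Prod>j\<in>{4<..5}. cmod (1 - y 4 / y j))"
    unfolding I(1) by (simp add: mult_ac)
  finally show ?thesis unfolding I by (simp add: mult_ac)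
qed

text \<open>\<open>y j\<close> is the denominator of \<open>j - 1\<close> factors, which explains
  the exponents.\<close>

lemma P_5_mult:
  assumes "y 2 \<noteq> 0" "y 3 \<noteq> 0" "y 4 \<noteq> 0" "y 5 \<noteq> 0"
  shows "P 5 y * (cmod (y 2) * (cmod (y 3))\<^sup>2 * cmod (y 4) ^ 3 * cmod (y 5) ^ 4)
    = cmod (y 1 - y 2) * cmod (y 1 - y 3) * cmod (y 1 - y 4) * cmod (y 1 - y 5)
    * cmod (y 2 - y 3) * cmod (y 2 - y 4) * cmod (y 2 - y 5)
    * cmod (y 3 - y 4) * cmod (y 3 - y 5) * cmod (y 4 - y 5)"
proof -
  have d: "cmod (u - v) = cmod (1 - u / v) * cmod v" if "v \<noteq> 0" for u v
    using that by (simp add: norm_mult[symmetric] left_diff_distrib norm_minus_commute)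
  show ?thesis
    unfolding P_5 d[OF assms(1)] d[OF assms(2)] d[OF assms(3)] d[OF assms(4)] by algebra
qed

text \<open>A real is equally far from \<open>z\<close> and \<open>cnj z\<close>, hence the squares
  in \<open>vdm\<close>. The variable \<open>w\<close> lets the second member of the pair be matched
  directly.\<close>

lemma vdm_eq:
  assumes "w = cnj z"
  shows "vdm z r1 r2 r3 = cmod (z - w)
    * cmod (of_real r1 - of_real r2) * cmod (of_real r1 - of_real r3) * cmod (of_real r2 - of_real r3)
    * cmod (of_real r1 - z) * cmod (of_real r1 - w) * cmod (of_real r2 - z) * cmod (of_real r2 - w)
    * cmod (of_real r3 - z) * cmod (of_real r3 - w)"
proof -
  have "cmod (of_real r - w) = cmod (of_real r - z)" for r
    unfolding assms by (metis complex_cnj_complex_of_real complex_cnj_diff complex_mod_cnj)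
  moreover have "cmod (z - w) = 2 * \<bar>Im z\<bar>"
    by (simp add: assms complex_diff_cnj norm_mult)
  moreover have "cmod (of_real r - of_real t) = \<bar>r - t\<bar>" for r t
    by (metis norm_of_real of_real_diff)
  ultimately show ?thesis by (simp add: vdm_def power2_eq_square mult_ac)
qed

text \<open>Reals standing between the two members have the modulus of the pair, so they count as
  lying on or outside the circle. Hence the first index \<open>i\<close> alone decides which of the
  four bounds on \<open>vdm\<close> covers each of the ten positions.\<close>

lemma P_5_le_of_pair:
  assumes pos: "0 < cmod (y 1)"
    and mono: "\<And>i j. 1 \<le> i \<Longrightarrow> i \<le> j \<Longrightarrow> j \<le> 5 \<Longrightarrow> cmod (y i) \<le> cmod (y j)"
    and ij: "1 \<le> i" "i < j" "j \<le> (5::nat)" and pair: "y j = cnj (y i)"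
    and reals: "\<And>k. 1 \<le> k \<Longrightarrow> k \<le> 5 \<Longrightarrow> k \<noteq> i \<Longrightarrow> k \<noteq> j \<Longrightarrow> y k \<in> \<real>"
  shows "P 5 y \<le> 16 * M"
proof -
  define m where "m k = cmod (y k)" for k
  define r where "r k = Re (y k)" for k
  define D where "D k l = cmod (y k - y l)" for k l
  define W where "W = m 2 * (m 3)\<^sup>2 * m 4 ^ 3 * m 5 ^ 4"
  have D_sym: "D k l = D l k" for k l by (simp add: D_def norm_minus_commute)
  have chain: "m 1 \<le> m 2" "m 2 \<le> m 3" "m 3 \<le> m 4" "m 4 \<le> m 5" by (auto simp: m_def intro!: mono)
  have m_pos: "0 < m 1" "0 < m 2" "0 < m 3" "0 < m 4" "0 < m 5" using pos chain by (auto simp: m_def)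
  have W_pos: "0 < W" using m_pos by (simp add: W_def)
  have m_pair: "m k = m i" if "i \<le> k" "k \<le> j" for k
    using mono[of i k] mono[of k j] that ij by (simp add: m_def pair)
  have y_real: "y k = of_real (r k)" "\<bar>r k\<bar> = m k" if "1 \<le> k" "k \<le> 5" "k \<noteq> i" "k \<noteq> j" for k
    using reals[OF that] by (auto simp: r_def m_def elim!: Reals_cases)
  \<comment> \<open>\<open>vdm_third\<close> and \<open>vdm_last\<close> ask for a nonzero second
    real, which for \<open>i \<ge> 3\<close> is the entry at position 2.\<close>
  have r2: "2 \<noteq> i \<Longrightarrow> 2 \<noteq> j \<Longrightarrow> r 2 \<noteq> 0" using y_real(2)[of 2] m_pos(2) by auto
  have PW: "P 5 y * W = D 1 2 * D 1 3 * D 1 4 * D 1 5 * D 2 3 * D 2 4 * D 2 5 * D 3 4 * D 3 5 * D 4 5"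
    using P_5_mult[of y] m_pos by (auto simp: W_def D_def m_def)
  have close: ?thesis
    if k: "{k1, k2, k3} \<subseteq> {1..5} - {i, j}"
      and D: "D 1 2 * D 1 3 * D 1 4 * D 1 5 * D 2 3 * D 2 4 * D 2 5 * D 3 4 * D 3 5 * D 4 5
        = D i j * D k1 k2 * D k1 k3 * D k2 k3 * D k1 i * D k1 j * D k2 i * D k2 j * D k3 i * D k3 j"
      and bound: "vdm (y i) (r k1) (r k2) (r k3) \<le> 16 * M * W" for k1 k2 k3
  proof -
    have "vdm (y i) (r k1) (r k2) (r k3) = P 5 y * W"
    proof -
      have "y k1 = of_real (r k1)" "y k2 = of_real (r k2)" "y k3 = of_real (r k3)"
        using k by (auto intro!: y_real(1))
      thus ?thesis unfolding PW D by (simp only: vdm_eq[OF pair] D_def)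
    qed
    hence "P 5 y * W \<le> 16 * M * W" using bound by simp
    thus ?thesis using W_pos by simp
  qed
  have "m 1 \<le> m i" unfolding m_def using ij by (intro mono) auto
  hence "0 < m i" using m_pos(1) by linarith
  note vdm_bounds = vdm_first[OF m_def[of i] this refl refl] vdm_second[OF m_def[of i] this refl refl]
    vdm_third[OF m_def[of i] this refl refl] vdm_last[OF m_def[of i] this refl refl]
  have "i = 1 \<or> i = 2 \<or> i = 3 \<or> i = 4" "j = 2 \<or> j = 3 \<or> j = 4 \<or> j = 5"
    using ij by linarith+
  with ij(2) consider "i = 1" "j = 2" | "i = 1" "j = 3" | "i = 1" "j = 4" | "i = 1" "j = 5"
    | "i = 2" "j = 3" | "i = 2" "j = 4" | "i = 2" "j = 5" | "i = 3" "j = 4" | "i = 3" "j = 5"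
    | "i = 4" "j = 5" by auto
  thus ?thesis
  proof cases
    case 1
    have b: "vdm (y i) (r 3) (r 4) (r 5) \<le> 16 * M * W"
      using vdm_bounds(1)[of "r 3" "r 4" "r 5"] chain m_pair[of 2] 1
      by (auto simp: y_real(2) W_def)
    show ?thesis
      by (rule close[OF _ _ b]) (simp add: 1, simp only: 1 D_sym mult_ac)
  next
    case 2
    have b: "vdm (y i) (r 2) (r 4) (r 5) \<le> 16 * M * W"
      using vdm_bounds(1)[of "r 2" "r 4" "r 5"] chain m_pair[of 2] m_pair[of 3] 2
      by (auto simp: y_real(2) W_def)
    show ?thesis
      by (rule close[OF _ _ b]) (simp add: 2, simp only: 2 D_sym mult_ac)
  next
    case 3
    have b: "vdm (y i) (r 2) (r 3) (r 5) \<le> 16 * M * W"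
      using vdm_bounds(1)[of "r 2" "r 3" "r 5"] chain m_pair[of 2] m_pair[of 3] m_pair[of 4] 3
      by (auto simp: y_real(2) W_def)
    show ?thesis
      by (rule close[OF _ _ b]) (simp add: 3, simp only: 3 D_sym mult_ac)
  next
    case 4
    have b: "vdm (y i) (r 2) (r 3) (r 4) \<le> 16 * M * W"
      using vdm_bounds(1)[of "r 2" "r 3" "r 4"] chain m_pair[of 2] m_pair[of 3] m_pair[of 4] m_pair[of 5] 4
      by (auto simp: y_real(2) W_def)
    show ?thesis
      by (rule close[OF _ _ b]) (simp add: 4, simp only: 4 D_sym mult_ac)
  next
    case 5
    have b: "vdm (y i) (r 1) (r 4) (r 5) \<le> 16 * M * W"
      using vdm_bounds(2)[of "r 1" "r 4" "r 5"] chain m_pair[of 3] 5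
      by (auto simp: y_real(2) W_def)
    show ?thesis
      by (rule close[OF _ _ b]) (simp add: 5, simp only: 5 D_sym mult_ac)
  next
    case 6
    have b: "vdm (y i) (r 1) (r 3) (r 5) \<le> 16 * M * W"
      using vdm_bounds(2)[of "r 1" "r 3" "r 5"] chain m_pair[of 3] m_pair[of 4] 6
      by (auto simp: y_real(2) W_def)
    show ?thesis
      by (rule close[OF _ _ b]) (simp add: 6, simp only: 6 D_sym mult_ac)
  next
    case 7
    have b: "vdm (y i) (r 1) (r 3) (r 4) \<le> 16 * M * W"
      using vdm_bounds(2)[of "r 1" "r 3" "r 4"] chain m_pair[of 3] m_pair[of 4] m_pair[of 5] 7
      by (auto simp: y_real(2) W_def)
    show ?thesis
      by (rule close[OF _ _ b]) (simp add: 7, simp only: 7 D_sym mult_ac)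
  next
    case 8
    have b: "vdm (y i) (r 1) (r 2) (r 5) \<le> 16 * M * W"
      using vdm_bounds(3)[of "r 2" "r 1" "r 5"] chain m_pair[of 4] r2 8
      by (auto simp: y_real(2) W_def)
    show ?thesis
      by (rule close[OF _ _ b]) (simp add: 8, simp only: 8 D_sym mult_ac)
  next
    case 9
    have b: "vdm (y i) (r 1) (r 2) (r 4) \<le> 16 * M * W"
      using vdm_bounds(3)[of "r 2" "r 1" "r 4"] chain m_pair[of 4] m_pair[of 5] r2 9
      by (auto simp: y_real(2) W_def)
    show ?thesis
      by (rule close[OF _ _ b]) (simp add: 9, simp only: 9 D_sym mult_ac)
  next
    case 10
    have b: "vdm (y i) (r 1) (r 2) (r 3) \<le> 16 * M * W"
      using vdm_bounds(4)[of "r 2" "r 1" "r 3"] chain m_pair[of 5] r2 10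
      by (auto simp: y_real(2) W_def)
    show ?thesis
      by (rule close[OF _ _ b]) (simp add: 10, simp only: 10 D_sym mult_ac)
  qed
qed

lemma admissible_5_1_pair:
  assumes "admissible 5 1 y"
  obtains i j where "1 \<le> i" "i < j" "j \<le> (5::nat)" "y j = cnj (y i)"
    "\<And>k. 1 \<le> k \<Longrightarrow> k \<le> 5 \<Longrightarrow> k \<noteq> i \<Longrightarrow> k \<noteq> j \<Longrightarrow> y k \<in> \<real>"
proof -
  from assms obtain I J c where sub: "I \<subseteq> {1..5}" "J \<subseteq> {1..5}" "I \<inter> J = {}"
    and card: "card I = 1" and bij: "bij_betw c I J"
    and cn: "\<forall>i\<in>I. y i \<notin> \<real> \<and> y (c i) = cnj (y i)"
    and re: "\<forall>k\<in>{1..5} - (I \<union> J). y k \<in> \<real>"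
    unfolding admissible_def by blast
  from card obtain i where I: "I = {i}" by (rule card_1_singletonE)
  hence J: "J = {c i}" using bij by (auto simp: bij_betw_def)
  have ne: "i \<noteq> c i" using sub I J by auto
  have bds: "1 \<le> i" "i \<le> 5" "1 \<le> c i" "c i \<le> 5" using sub I J by auto
  have eq: "y (c i) = cnj (y i)" using cn I by simp
  have re': "y k \<in> \<real>" if "1 \<le> k" "k \<le> 5" "k \<noteq> i" "k \<noteq> c i" for k
    using re that I J by simp
  show ?thesis
  proof (cases "i < c i")
    case True
    thus ?thesis using that[of i "c i"] bds eq re' by blast
  next
    case False
    hence "c i < i" using ne by simp
    moreover have "y i = cnj (y (c i))" using eq by simp
    ultimately show ?thesis using that[of "c i" i] bds re' by blast
  qed
qed

lemma P_5_le:
  assumes "admissible 5 1 y"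
  shows "P 5 y \<le> 16 * M"
proof (rule admissible_5_1_pair[OF assms])
  fix i j :: nat
  assume ij: "1 \<le> i" "i < j" "j \<le> 5" "y j = cnj (y i)"
    and re: "\<And>k. 1 \<le> k \<Longrightarrow> k \<le> 5 \<Longrightarrow> k \<noteq> i \<Longrightarrow> k \<noteq> j \<Longrightarrow> y k \<in> \<real>"
  have "0 < cmod (y 1)"
    and mono: "\<forall>i j. 1 \<le> i \<and> i \<le> j \<and> j \<le> 5 \<longrightarrow> cmod (y i) \<le> cmod (y j)"
    using assms unfolding admissible_def by blast+
  from this(1) _ ij re show ?thesis
  proof (rule P_5_le_of_pair)
    show "cmod (y k) \<le> cmod (y l)" if "1 \<le> k" "k \<le> l" "l \<le> 5" for k l
      using mono that by blast
  qed
qed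

section \<open>Sharpness\<close>

text \<open>The reals 1 and -1 are the ends in \<open>opposite_bound\<close>, and \<open>a\<close>,
  \<open>c\<close> give equality in \<open>core_bound\<close>. As the entries from position 2 on
  have modulus 1, \<open>P\<close> equals its numerator.\<close>

lemma P_5_attained: "\<exists>y. admissible 5 1 y \<and> P 5 y = 16 * M"
proof -
  define a where "a = 1 / sqrt 7"
  define c where "c = - a / 2"
  \<comment> \<open>\<open>c\<^sup>2 = 1 / 28\<close>, so this puts \<open>z\<close> on the unit
    circle.\<close>
  define s where "s = sqrt (27 / 28)"
  define z where "z = Complex c s"
  define y :: "nat \<Rightarrow> complex" where
    "y k = (if k = 1 then of_real a else if k = 2 then 1 else if k = 3 then - 1
      else if k = 4 then z else cnj z)" for k
  have a: "0 < a" "a\<^sup>2 = 1 / 7" "a \<le> 1" by (simp_all add: a_def power_divide)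
  have s: "0 < s" "s\<^sup>2 = 27 / 28" by (simp_all add: s_def)
  have cs: "c\<^sup>2 + s\<^sup>2 = 1" using a s by (simp add: c_def power_divide)
  have z1: "cmod z = 1" using cs by (simp add: z_def cmod_def)
  have ys: "y 1 = of_real a" "y 2 = of_real 1" "y 3 = of_real (- 1)" "y 4 = z" "y 5 = cnj z"
    by (simp_all add: y_def)
  have norms: "cmod (y k) = (if k = 1 then a else 1)" for k
    using a(1) z1 by (simp add: y_def)
  have "y 4 \<notin> \<real>" using s(1) by (simp add: ys complex_is_Real_iff z_def)
  moreover have "y k \<in> \<real>" if "k \<noteq> 4" "k \<noteq> 5" "1 \<le> k" "k \<le> 5" for k
  proof -
    have "k = 1 \<or> k = 2 \<or> k = 3" using that by linarith
    thus ?thesis using ys(1-3) by (elim disjE) (simp_all only: Reals_of_real)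
  qed
  moreover have "y 5 = cnj (y 4)" by (simp add: ys)
  ultimately have ex: "\<exists>I J c. I \<subseteq> {1..5} \<and> J \<subseteq> {1..5} \<and> I \<inter> J = {} \<and> card I = 1 \<and> bij_betw c I J \<and>
      (\<forall>i\<in>I. y i \<notin> \<real> \<and> y (c i) = cnj (y i)) \<and> (\<forall>k\<in>{1..5} - (I \<union> J). y k \<in> \<real>)"
    by (intro exI[of _ "{4}"] exI[of _ "{5}"] exI[of _ "\<lambda>_. 5"]) (simp add: bij_betw_def)
  have adm: "admissible 5 1 y"
    unfolding admissible_def
  proof (intro conjI ex)
    show "\<forall>i j. 1 \<le> i \<and> i \<le> j \<and> j \<le> 5 \<longrightarrow> cmod (y i) \<le> cmod (y j)"
      using a(3) unfolding norms by auto
    show "0 < cmod (y 1)" using a(1) unfolding norms by simp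
  qed simp_all
  have vq: "(cmod (of_real r - z))\<^sup>2 = q c r" for r
  proof -
    have "1 = cmod z" "(0::real) < 1" "c = Re z / 1" "s = \<bar>Im z\<bar> / 1"
      using z1 s(1) by (simp_all add: z_def)
    from dist_inner[OF this, of r] show ?thesis by simp
  qed
  have "P 5 y = P 5 y * (cmod (y 2) * (cmod (y 3))\<^sup>2 * cmod (y 4) ^ 3 * cmod (y 5) ^ 4)"
    unfolding norms by simp
  also have "\<dots> = vdm z a 1 (- 1)"
  proof -
    have nz: "y 2 \<noteq> 0" "y 3 \<noteq> 0" "y 4 \<noteq> 0" "y 5 \<noteq> 0" using z1 by (auto simp: ys)
    show ?thesis
      unfolding P_5_mult[OF nz] vdm_eq[OF refl] unfolding ys
      by (simp only: mult_ac)
  qed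
  also have "\<dots> = 2 * s * (1 - a) * (1 + a) * 2 * q c a * q c 1 * q c (- 1)"
  proof -
    have "\<bar>Im z\<bar> = s" "\<bar>a - 1\<bar> = 1 - a" "\<bar>a - - 1\<bar> = 1 + a" "\<bar>1 - - 1\<bar> = (2::real)"
      using a s(1) by (simp_all add: z_def)
    thus ?thesis unfolding vdm_def vq by (simp only:)
  qed
  also have "\<dots> = 4 * s * (1 - a\<^sup>2) * q c a * (4 * s\<^sup>2)"
  proof -
    have "q c 1 * q c (- 1) = 4 * s\<^sup>2"
      using cs by (simp add: q_def power2_eq_square algebra_simps)
    moreover have "2 * s * (1 - a) * (1 + a) * 2 * q c a * q c 1 * q c (- 1)
        = 4 * s * ((1 - a) * (1 + a)) * q c a * (q c 1 * q c (- 1))"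
      by simp
    moreover have "(1 - a) * (1 + a) = 1 - a\<^sup>2" by (simp add: power2_eq_square algebra_simps)
    ultimately show ?thesis by (simp only:)
  qed
  also have "\<dots> = 16 * M"
  proof -
    have qa: "q c a = 9 / 7" using a(2) by (simp add: q_def c_def power2_eq_square)
    \<comment> \<open>54/49 is \<open>(1 - a\<^sup>2) * q c a = (6 / 7) * (9 / 7)\<close>; comparing
      squares removes the roots in \<open>s\<close> and \<open>M\<close>.\<close>
    have "(s * s\<^sup>2 * (54 / 49))\<^sup>2 = (s\<^sup>2) ^ 3 * (54 / 49)\<^sup>2"
      unfolding power_mult_distrib by (simp only: power3_eq_cube power2_eq_square mult_ac)
    also have "\<dots> = M\<^sup>2" unfolding M_square s(2) by (simp add: power_divide)
    finally have "(s * s\<^sup>2 * (54 / 49))\<^sup>2 = M\<^sup>2" .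
    moreover have "0 \<le> s * s\<^sup>2 * (54 / 49)" using s(1) by simp
    ultimately have "s * s\<^sup>2 * (54 / 49) = M" using M_nonneg by (rule power2_eq_imp_eq)
    moreover have "4 * s * (1 - a\<^sup>2) * q c a * (4 * s\<^sup>2) = 16 * (s * s\<^sup>2 * (54 / 49))"
      unfolding qa a(2) by simp
    ultimately show ?thesis by (simp only:)
  qed
  finally show ?thesis using adm by blast
qed

theorem theorem1:
  shows "(\<forall>y. admissible 5 1 y \<longrightarrow> P 5 y \<le> 16 * M)
    \<and> 16.6965 \<le> 16 * M \<and> 16 * M < 16.6966
    \<and> (\<forall>C. (\<forall>y. admissible 5 1 y \<longrightarrow> P 5 y \<le> C) \<longrightarrow> 16 * M \<le> C)"
proof (intro conjI allI impI)
  fix C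
  assume "\<forall>y. admissible 5 1 y \<longrightarrow> P 5 y \<le> C"
  thus "16 * M \<le> C" using P_5_attained by metis
qed (use P_5_le M_lower M_upper in auto)

end
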